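(* Let $F:\mathbf{Set}\to\mathbf{Set}$ be a functor that is a coproduct of covariant hom functors, i.e. there is a non-empty family of sets $(X_i)_{i\in I}$ with $F=\coprod_{i\in I}\hom(X_i,-)$. Then the set of natural transformations $F\times F\to F$ is in bijection with $\prod_{i,j\in I}F(X_i+X_j)$: \[ [\mathbf{Set},\mathbf{Set}](F\times F,F)\cong\prod_{i,j\in I}F(X_i+X_j). \]
   Context: $F\times F$ denotes the pointwise product functor $X\mapsto FX\times FX$, and $X_i+X_j$ the disjoint union (coproduct) of sets. *)

theory Defs
  imports "HOL-Library.FuncSet" "HOL-Library.Equipollence"
begin

section \<open>A universe of sets\<close>

text \<open>
  HOL has no type of all sets, so the category \<open>Set\<close> is taken relative to an arbitrary universe: a
  type \<open>'v\<close> whose elements are the sets, with the membership relation given by \<open>elts\<close>.  A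
  collection \<open>B :: 'v set\<close> is a set in the universe iff \<open>B \<in> range elts\<close>, and is a proper class
  otherwise.  The class axioms are extensionality, separation, union, power set and replacement
  (for arbitrary class functions); the existence of the empty set and of pairs follows.  Full ZFC,
  with Infinity and Foundation, would pin \<open>Set\<close> down to the usual category.  Nothing below depends
  on these two axioms, so they are not assumed: this keeps every ZFC universe as an instance, and
  makes the class provably inhabited in HOL, by the hereditarily finite sets (type \<open>nat\<close> with
  \<open>elts = set_decode\<close>).
\<close>

class set_universe =
  fixes elts :: "'a \<Rightarrow> 'a set"
  assumes inj_elts: "inj elts"
    and separation: "B \<subseteq> elts x \<Longrightarrow> B \<in> range elts"
    and union: "(\<Union>y\<in>elts x. elts y) \<in> range elts"
    and power: "{y. elts y \<subseteq> elts x} \<in> range elts"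
    and replacement: "f ` elts x \<in> range elts"

definition vset :: "'v::set_universe set \<Rightarrow> 'v" where
  "vset A = inv elts A"

lemma vset_elts [simp]: "vset (elts x) = x"
  by (simp add: vset_def inj_elts)

lemma elts_vset: "A \<in> range elts \<Longrightarrow> elts (vset A) = A"
  by (simp add: vset_def f_inv_into_f)

lemma elts_eqI: "elts x = elts y \<Longrightarrow> x = y"
  by (rule injD[OF inj_elts])

lemma small_empty: "{} \<in> range elts"
  using separation by blast

lemma small_image:
  fixes f :: "'v::set_universe \<Rightarrow> 'v"
  shows "A \<in> range elts \<Longrightarrow> f ` A \<in> range elts"
  using replacement by blast

lemma small_UN:
  fixes B :: "'v::set_universe \<Rightarrow> 'v set"
  assumes "A \<in> range elts" "\<And>a. a \<in> A \<Longrightarrow> B a \<in> range elts"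
  shows "(\<Union>a\<in>A. B a) \<in> range elts"
proof -
  have "(\<lambda>a. vset (B a)) ` A \<in> range elts"
    by (rule small_image) fact
  then obtain x where x: "(\<lambda>a. vset (B a)) ` A = elts x"
    by (rule rangeE)
  have "(\<Union>y\<in>elts x. elts y) = (\<Union>a\<in>A. B a)"
    unfolding x[symmetric] using assms(2) by (simp add: elts_vset)
  then show ?thesis
    using union[of x] by simp
qed

lemma small_pair: "{a, b :: 'v::set_universe} \<in> range elts"
proof -
  let ?P = "\<lambda>x :: 'v. {y. elts y \<subseteq> elts x}"
  define e :: 'v where "e = vset {}"
  have e: "elts e = {}"
    by (simp add: e_def elts_vset small_empty)
  obtain s where s: "?P e = elts s"
    using power by (rule rangeE)
  obtain t where t: "?P s = elts t"
    using power by (rule rangeE)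
  have "e \<in> elts s"
    using e by (simp flip: s)
  then have "s \<noteq> e"
    using e by blast
  have "e \<in> elts t" "s \<in> elts t"
    using e by (simp_all flip: t)
  then have "(\<lambda>x. if x = e then a else b) ` elts t = {a, b}"
    using \<open>s \<noteq> e\<close> by (force split: if_splits)
  then show ?thesis
    using replacement[of "\<lambda>x. if x = e then a else b" t] by simp
qed

lemma small_Un:
  assumes "A \<in> range elts" "B \<in> range elts"
  shows "A \<union> B \<in> range elts"
proof -
  have "(\<Union>x\<in>{vset A, vset B}. elts x) \<in> range elts"
    by (rule small_UN[OF small_pair]) auto
  then show ?thesis
    using assms by (simp add: elts_vset)
qed


section \<open>Set-theoretic constructions inside the universe\<close>

definition vpair :: "'v::set_universe \<Rightarrow> 'v \<Rightarrow> 'v" where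
  "vpair a b = vset {vset {a}, vset {a, b}}"

definition vfst :: "'v::set_universe \<Rightarrow> 'v" where
  "vfst p = (THE a. \<exists>b. p = vpair a b)"

definition vsnd :: "'v::set_universe \<Rightarrow> 'v" where
  "vsnd p = (THE b. \<exists>a. p = vpair a b)"

definition vSigma :: "'v::set_universe \<Rightarrow> ('v \<Rightarrow> 'v) \<Rightarrow> 'v" where
  "vSigma I B = vset {vpair i x |i x. i \<in> elts I \<and> x \<in> elts (B i)}"

definition vtimes :: "'v::set_universe \<Rightarrow> 'v \<Rightarrow> 'v" where
  "vtimes A B = vSigma A (\<lambda>_. B)"

text \<open>The disjoint union \<open>A + B\<close>, with the empty set and its singleton as tags.\<close>

definition vInl :: "'v::set_universe \<Rightarrow> 'v" where
  "vInl a = vpair (vset {}) a"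

definition vInr :: "'v::set_universe \<Rightarrow> 'v" where
  "vInr b = vpair (vset {vset {}}) b"

definition vsum :: "'v::set_universe \<Rightarrow> 'v \<Rightarrow> 'v" where
  "vsum A B = vset (vInl ` elts A \<union> vInr ` elts B)"

text \<open>
  A map \<open>A \<rightarrow> B\<close> of the category \<open>Set\<close> is a HOL function that is extensional on \<open>elts A\<close>.  Since
  the values of a hom functor are themselves sets, the maps are also coded by their graphs, and
  \<open>vhom A B\<close> is the set of these graphs.
\<close>

definition set_hom :: "'v::set_universe \<Rightarrow> 'v \<Rightarrow> ('v \<Rightarrow> 'v) set" where
  "set_hom A B = elts A \<rightarrow>\<^sub>E elts B"

definition vgraph :: "'v::set_universe \<Rightarrow> ('v \<Rightarrow> 'v) \<Rightarrow> 'v" where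
  "vgraph A f = vset ((\<lambda>x. vpair x (f x)) ` elts A)"

definition vapp :: "'v::set_universe \<Rightarrow> 'v \<Rightarrow> 'v" where
  "vapp g x = (THE y. vpair x y \<in> elts g)"

definition vhom :: "'v::set_universe \<Rightarrow> 'v \<Rightarrow> 'v" where
  "vhom A B = vset (vgraph A ` set_hom A B)"

lemma vpair_eq_iff [simp]: "vpair a b = vpair c d \<longleftrightarrow> a = c \<and> b = d"
proof
  have pair: "elts (vset {x, y}) = {x, y}" for x y :: 'a
    by (rule elts_vset[OF small_pair])
  have single: "elts (vset {x}) = {x}" for x :: 'a
    using pair[of x x] by simp
  assume "vpair a b = vpair c d"
  then have "elts (vpair a b) = elts (vpair c d)"
    by (rule arg_cong)
  then have "{vset {a}, vset {a, b}} = {vset {c}, vset {c, d}}"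
    by (simp only: vpair_def pair)
  then have "elts ` {vset {a}, vset {a, b}} = elts ` {vset {c}, vset {c, d}}"
    by (rule arg_cong)
  then have "{{a}, {a, b}} = {{c}, {c, d}}"
    by (simp add: pair single)
  then show "a = c \<and> b = d"
    by (auto simp: doubleton_eq_iff)
qed auto

lemma vfst_vpair [simp]: "vfst (vpair a b) = a"
  by (auto simp: vfst_def)

lemma vsnd_vpair [simp]: "vsnd (vpair a b) = b"
  by (auto simp: vsnd_def)

lemma elts_vSigma: "elts (vSigma I B) = {vpair i x |i x. i \<in> elts I \<and> x \<in> elts (B i)}"
proof -
  have "{vpair i x |i x. i \<in> elts I \<and> x \<in> elts (B i)} = (\<Union>i\<in>elts I. vpair i ` elts (B i))"
    by auto
  also have "\<dots> \<in> range elts"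
    by (intro small_UN replacement) auto
  finally show ?thesis
    by (simp add: vSigma_def elts_vset)
qed

lemma elts_vtimes: "elts (vtimes A B) = {vpair a b |a b. a \<in> elts A \<and> b \<in> elts B}"
  by (simp add: vtimes_def elts_vSigma)

lemma vInl_eq_iff [simp]: "vInl a = vInl b \<longleftrightarrow> a = b"
  by (simp add: vInl_def)

lemma vInr_eq_iff [simp]: "vInr a = vInr b \<longleftrightarrow> a = b"
  by (simp add: vInr_def)

lemma vInl_neq_vInr [simp]: "vInl a \<noteq> vInr b"
proof
  assume "vInl a = vInr b"
  then have "elts (vset {} :: 'a) = elts (vset {vset {}})"
    by (simp add: vInl_def vInr_def)
  then show False
    using small_pair[of "vset {} :: 'a" "vset {}"] by (simp add: elts_vset small_empty)
qed

lemma elts_vsum: "elts (vsum A B) = vInl ` elts A \<union> vInr ` elts B"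
  by (simp add: vsum_def elts_vset small_Un replacement)

lemma elts_vgraph: "elts (vgraph A f) = (\<lambda>x. vpair x (f x)) ` elts A"
  by (simp add: vgraph_def elts_vset replacement)

lemma vapp_vgraph [simp]: "x \<in> elts A \<Longrightarrow> vapp (vgraph A f) x = f x"
  by (auto simp: vapp_def elts_vgraph image_iff)

lemma vgraph_inj_on: "inj_on (vgraph A) (set_hom A B)"
proof (rule inj_onI)
  fix f g
  assume "f \<in> set_hom A B" "g \<in> set_hom A B" and eq: "vgraph A f = vgraph A g"
  moreover have "f x = g x" if "x \<in> elts A" for x
    using that arg_cong[OF eq, of "\<lambda>h. vapp h x"] by simp
  ultimately show "f = g"
    unfolding set_hom_def by (simp add: PiE_ext)
qed

lemma elts_vhom: "elts (vhom A B) = vgraph A ` set_hom A B"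
proof -
  have "elts (vgraph A f) \<subseteq> elts (vtimes A B)" if "f \<in> set_hom A B" for f
    using that by (auto simp: elts_vgraph elts_vtimes set_hom_def)
  then have "vgraph A ` set_hom A B \<subseteq> {y. elts y \<subseteq> elts (vtimes A B)}"
    by blast
  moreover obtain p where "{y. elts y \<subseteq> elts (vtimes A B)} = elts p"
    using power by (rule rangeE)
  ultimately have "vgraph A ` set_hom A B \<in> range elts"
    by (simp add: separation)
  then show ?thesis
    by (simp add: vhom_def elts_vset)
qed


section \<open>Functors on the category of sets\<close>

text \<open>
  As a map does not determine its codomain, the action of \<open>F\<close> on \<open>f : A \<rightarrow> B\<close> also takes the
  objects: it is \<open>arr F A B f\<close>.
\<close>

record 'v endo =
  obj :: "'v \<Rightarrow> 'v"
  arr :: "'v \<Rightarrow> 'v \<Rightarrow> ('v \<Rightarrow> 'v) \<Rightarrow> 'v \<Rightarrow> 'v"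

definition set_functor :: "'v::set_universe endo \<Rightarrow> bool" where
  "set_functor F \<longleftrightarrow>
     (\<forall>A B. \<forall>f\<in>set_hom A B. arr F A B f \<in> set_hom (obj F A) (obj F B)) \<and>
     (\<forall>A. arr F A A (\<lambda>x\<in>elts A. x) = (\<lambda>x\<in>elts (obj F A). x)) \<and>
     (\<forall>A B C. \<forall>f\<in>set_hom A B. \<forall>g\<in>set_hom B C.
        arr F A C (compose (elts A) g f) =
        compose (elts (obj F A)) (arr F B C g) (arr F A B f))"

definition nat_trans :: "'v::set_universe endo \<Rightarrow> 'v endo \<Rightarrow> ('v \<Rightarrow> 'v \<Rightarrow> 'v) set" where
  "nat_trans F G =
     {\<alpha>. (\<forall>A. \<alpha> A \<in> set_hom (obj F A) (obj G A)) \<and>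
         (\<forall>A B. \<forall>f\<in>set_hom A B.
            compose (elts (obj F A)) (arr G A B f) (\<alpha> A) =
            compose (elts (obj F A)) (\<alpha> B) (arr F A B f))}"

definition nat_isomorphic :: "'v::set_universe endo \<Rightarrow> 'v endo \<Rightarrow> bool" where
  "nat_isomorphic F G \<longleftrightarrow>
     (\<exists>\<alpha>\<in>nat_trans F G. \<forall>A. bij_betw (\<alpha> A) (elts (obj F A)) (elts (obj G A)))"

definition hom_functor :: "'v::set_universe \<Rightarrow> 'v endo" where
  "hom_functor X =
     \<lparr>obj = vhom X,
      arr = (\<lambda>A B f. \<lambda>g\<in>elts (vhom X A). vgraph X (\<lambda>x. f (vapp g x)))\<rparr>"

definition coproduct_functor :: "'v::set_universe \<Rightarrow> ('v \<Rightarrow> 'v endo) \<Rightarrow> 'v endo" where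
  "coproduct_functor I G =
     \<lparr>obj = (\<lambda>A. vSigma I (\<lambda>i. obj (G i) A)),
      arr = (\<lambda>A B f. \<lambda>p\<in>elts (vSigma I (\<lambda>i. obj (G i) A)).
               vpair (vfst p) (arr (G (vfst p)) A B f (vsnd p)))\<rparr>"

definition product_functor :: "'v::set_universe endo \<Rightarrow> 'v endo \<Rightarrow> 'v endo" where
  "product_functor F G =
     \<lparr>obj = (\<lambda>A. vtimes (obj F A) (obj G A)),
      arr = (\<lambda>A B f. \<lambda>p\<in>elts (vtimes (obj F A) (obj G A)).
               vpair (arr F A B f (vfst p)) (arr G A B f (vsnd p)))\<rparr>"

end

theory Submission
  imports Defs
begin

text \<open>
  A coproduct of hom functors \<open>F\<close> carries universal elements \<open>u\<^sub>i \<in> F X\<^sub>i\<close>: every \<open>x \<in> F A\<close> is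
  \<open>F f u\<^sub>i\<close> for a unique \<open>i\<close> and a unique \<open>f : X\<^sub>i \<rightarrow> A\<close>.  As a pair of maps \<open>X\<^sub>i \<rightarrow> A\<close>,
  \<open>X\<^sub>j \<rightarrow> A\<close> is the same as a map \<open>X\<^sub>i + X\<^sub>j \<rightarrow> A\<close>, the pairs \<open>(F inl u\<^sub>i, F inr u\<^sub>j)\<close> are universal
  elements of \<open>F \<times> F\<close>.  By the Yoneda argument a natural transformation out of a functor with
  universal elements is determined by its values on them, and these can be chosen freely.
\<close>

text \<open>Such a family amounts to a decomposition of \<open>G\<close> into hom functors
  represented by the \<open>R k\<close>. The index type is arbitrary, so pairs of indices can serve
  as indices without being coded in the universe.\<close>

definition universal_family ::
    "'v::set_universe endo \<Rightarrow> 'k set \<Rightarrow> ('k \<Rightarrow> 'v) \<Rightarrow> ('k \<Rightarrow> 'v) \<Rightarrow> bool" where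
  "universal_family G K R u \<longleftrightarrow>
     (\<forall>k\<in>K. u k \<in> elts (obj G (R k))) \<and>
     (\<forall>A. bij_betw (\<lambda>(k, f). arr G (R k) A f (u k)) (SIGMA k:K. set_hom (R k) A) (elts (obj G A)))"

section \<open>Elementwise rules for maps, functors and natural transformations\<close>

lemma set_hom_app: "f \<in> set_hom A B \<Longrightarrow> x \<in> elts A \<Longrightarrow> f x \<in> elts B"
  by (auto simp: set_hom_def)

lemma set_hom_eqI:
  "\<lbrakk>f \<in> set_hom A B; g \<in> set_hom A B; \<And>x. x \<in> elts A \<Longrightarrow> f x = g x\<rbrakk> \<Longrightarrow> f = g"
  unfolding set_hom_def by (rule PiE_ext)

lemma set_hom_id: "(\<lambda>x\<in>elts A. x) \<in> set_hom A A"
  by (auto simp: set_hom_def)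

lemma set_hom_compose:
  "f \<in> set_hom A B \<Longrightarrow> g \<in> set_hom B C \<Longrightarrow> compose (elts A) g f \<in> set_hom A C"
  by (auto simp: set_hom_def compose_def)

lemma set_functor_arr:
  "set_functor F \<Longrightarrow> f \<in> set_hom A B \<Longrightarrow> arr F A B f \<in> set_hom (obj F A) (obj F B)"
  by (simp add: set_functor_def)

lemma set_functor_app:
  "set_functor F \<Longrightarrow> f \<in> set_hom A B \<Longrightarrow> x \<in> elts (obj F A) \<Longrightarrow> arr F A B f x \<in> elts (obj F B)"
  by (rule set_hom_app[OF set_functor_arr])

lemma set_functor_id:
  "set_functor F \<Longrightarrow> x \<in> elts (obj F A) \<Longrightarrow> arr F A A (\<lambda>x\<in>elts A. x) x = x"
  by (simp add: set_functor_def)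

lemma set_functor_compose:
  assumes "set_functor F" "f \<in> set_hom A B" "g \<in> set_hom B C" "x \<in> elts (obj F A)"
  shows "arr F B C g (arr F A B f x) = arr F A C (compose (elts A) g f) x"
proof -
  have "arr F A C (compose (elts A) g f) = compose (elts (obj F A)) (arr F B C g) (arr F A B f)"
    using assms unfolding set_functor_def by blast
  then show ?thesis
    using assms(4) by (simp add: compose_def)
qed

lemma nat_trans_app:
  "\<alpha> \<in> nat_trans F G \<Longrightarrow> x \<in> elts (obj F A) \<Longrightarrow> \<alpha> A x \<in> elts (obj G A)"
  unfolding nat_trans_def by (blast intro: set_hom_app)

lemma nat_trans_natural:
  assumes "\<alpha> \<in> nat_trans F G" "f \<in> set_hom A B" "x \<in> elts (obj F A)"
  shows "\<alpha> B (arr F A B f x) = arr G A B f (\<alpha> A x)"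
proof -
  have "compose (elts (obj F A)) (arr G A B f) (\<alpha> A) = compose (elts (obj F A)) (\<alpha> B) (arr F A B f)"
    using assms unfolding nat_trans_def by blast
  from fun_cong[OF this, of x] show ?thesis
    using assms(3) by (simp add: compose_def)
qed

lemma nat_transI:
  assumes "\<And>A. \<alpha> A \<in> set_hom (obj F A) (obj G A)"
    and "\<And>A B f x. f \<in> set_hom A B \<Longrightarrow> x \<in> elts (obj F A) \<Longrightarrow>
           \<alpha> B (arr F A B f x) = arr G A B f (\<alpha> A x)"
  shows "\<alpha> \<in> nat_trans F G"
  using assms by (simp add: nat_trans_def compose_def fun_eq_iff restrict_def)

lemma set_functor_product:
  fixes F G :: "'v::set_universe endo"
  assumes F: "set_functor F" and G: "set_functor G"
  shows "set_functor (product_functor F G)"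
  unfolding set_functor_def
proof (intro conjI allI ballI)
  fix A B :: 'v and f
  assume "f \<in> set_hom A B"
  then show "arr (product_functor F G) A B f \<in>
      set_hom (obj (product_functor F G) A) (obj (product_functor F G) B)"
    using set_functor_app[OF F] set_functor_app[OF G]
    by (auto simp: product_functor_def set_hom_def[of "vtimes _ _"] elts_vtimes)
next
  fix A
  show "arr (product_functor F G) A A (\<lambda>x\<in>elts A. x) =
      (\<lambda>x\<in>elts (obj (product_functor F G) A). x)"
    using set_functor_id[OF F] set_functor_id[OF G]
    by (auto simp: product_functor_def elts_vtimes restrict_def fun_eq_iff)
next
  fix A B C :: 'v and f g
  assume f: "f \<in> set_hom A B" and g: "g \<in> set_hom B C"
  show "arr (product_functor F G) A C (compose (elts A) g f) =
      compose (elts (obj (product_functor F G) A))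
        (arr (product_functor F G) B C g) (arr (product_functor F G) A B f)"
    using set_functor_compose[OF F f g] set_functor_compose[OF G f g]
      set_functor_app[OF F f] set_functor_app[OF G f]
    \<comment> \<open>Only the composite over the set of pairs is unfolded;
      \<open>compose (elts A) g f\<close> stays intact, so that functoriality of each factor applies
      to it.\<close>
    by (auto simp: product_functor_def elts_vtimes compose_def[of "{vpair a b |a b. _ a b}"]
        fun_eq_iff restrict_def)
qed

section \<open>Universal families and the Yoneda argument\<close>

lemma universal_family_elt:
  "universal_family G K R u \<Longrightarrow> k \<in> K \<Longrightarrow> u k \<in> elts (obj G (R k))"
  by (simp add: universal_family_def)

lemma universal_family_unique:
  assumes "universal_family G K R u" "k \<in> K" "l \<in> K" "f \<in> set_hom (R k) A" "g \<in> set_hom (R l) A"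
    and "arr G (R k) A f (u k) = arr G (R l) A g (u l)"
  shows "k = l \<and> f = g"
proof -
  have "inj_on (\<lambda>(k, f). arr G (R k) A f (u k)) (SIGMA k:K. set_hom (R k) A)"
    using assms(1) by (simp add: universal_family_def bij_betw_def)
  from inj_onD[OF this, of "(k, f)" "(l, g)"] show ?thesis
    using assms(2-) by simp
qed

lemma universal_family_ex:
  assumes "universal_family G K R u" "x \<in> elts (obj G A)"
  obtains k f where "k \<in> K" "f \<in> set_hom (R k) A" "x = arr G (R k) A f (u k)"
proof -
  have "(\<lambda>(k, f). arr G (R k) A f (u k)) ` (SIGMA k:K. set_hom (R k) A) = elts (obj G A)"
    using assms(1) by (simp add: universal_family_def bij_betw_def)
  then show ?thesis
    using assms(2) that by fastforce
qed

text \<open>The bijection evaluates \<alpha> at the universal elements. Naturality forces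
  \<open>\<alpha> A (G f u_k) = F f (\<alpha> (R k) u_k)\<close>, which gives injectivity; the same
  formula, read as a definition, gives surjectivity.\<close>

lemma nat_trans_universal_family_eqpoll:
  assumes F: "set_functor F" and G: "set_functor G" and u: "universal_family G K R u"
  shows "nat_trans G F \<approx> (\<Pi>\<^sub>E k\<in>K. elts (obj F (R k)))"
proof -
  let ?eval = "\<lambda>\<alpha>. \<lambda>k\<in>K. \<alpha> (R k) (u k)"
  note u_elt = universal_family_elt[OF u]
  have "inj_on ?eval (nat_trans G F)"
  proof (rule inj_onI)
    fix \<alpha> \<beta>
    assume \<alpha>: "\<alpha> \<in> nat_trans G F" and \<beta>: "\<beta> \<in> nat_trans G F" and eq: "?eval \<alpha> = ?eval \<beta>"
    show "\<alpha> = \<beta>"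
    proof
      fix A
      show "\<alpha> A = \<beta> A"
      proof (rule set_hom_eqI)
        show "\<alpha> A \<in> set_hom (obj G A) (obj F A)" "\<beta> A \<in> set_hom (obj G A) (obj F A)"
          using \<alpha> \<beta> by (auto simp: nat_trans_def)
        fix x
        assume "x \<in> elts (obj G A)"
        then obtain k f where k: "k \<in> K" "f \<in> set_hom (R k) A" "x = arr G (R k) A f (u k)"
          by (rule universal_family_ex[OF u])
        have "\<alpha> (R k) (u k) = \<beta> (R k) (u k)"
          using fun_cong[OF eq, of k] k(1) by simp
        then show "\<alpha> A x = \<beta> A x"
          using k u_elt by (simp add: nat_trans_natural[OF \<alpha>] nat_trans_natural[OF \<beta>])
      qed
    qed
  qed
  moreover have "?eval ` nat_trans G F = (\<Pi>\<^sub>E k\<in>K. elts (obj F (R k)))"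
  proof (intro equalityI subsetI)
    fix c
    assume "c \<in> ?eval ` nat_trans G F"
    then obtain \<alpha> where "\<alpha> \<in> nat_trans G F" and c: "c = ?eval \<alpha>"
      by blast
    then show "c \<in> (\<Pi>\<^sub>E k\<in>K. elts (obj F (R k)))"
      unfolding c using nat_trans_app u_elt by fastforce
  next
    fix c
    assume c: "c \<in> (\<Pi>\<^sub>E k\<in>K. elts (obj F (R k)))"
    \<comment> \<open>The Yoneda formula: \<open>G f u_k\<close> is sent to \<open>F f c_k\<close>.
      Uniqueness of \<open>k\<close> and \<open>f\<close> makes the description well defined, and
      the restriction makes each component extensional.\<close>
    define \<alpha> where "\<alpha> A = (\<lambda>x\<in>elts (obj G A). THE y.
      \<exists>k\<in>K. \<exists>f\<in>set_hom (R k) A. x = arr G (R k) A f (u k) \<and> y = arr F (R k) A f (c k))" for A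
    have c_elt: "c k \<in> elts (obj F (R k))" if "k \<in> K" for k
      using c that by auto
    have \<alpha>_eq: "\<alpha> A (arr G (R k) A f (u k)) = arr F (R k) A f (c k)"
      if "k \<in> K" "f \<in> set_hom (R k) A" for A k f
    proof -
      have "(THE y. \<exists>l\<in>K. \<exists>g\<in>set_hom (R l) A.
          arr G (R k) A f (u k) = arr G (R l) A g (u l) \<and> y = arr F (R l) A g (c l)) =
        arr F (R k) A f (c k)"
        using that by (intro the_equality) (auto dest: universal_family_unique[OF u])
      then show ?thesis
        using that set_functor_app[OF G] u_elt by (simp add: \<alpha>_def)
    qed
    have "\<alpha> \<in> nat_trans G F"
    proof (rule nat_transI)
      fix A
      have "\<alpha> A x \<in> elts (obj F A)" if "x \<in> elts (obj G A)" for x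
      proof -
        from that obtain k f where k: "k \<in> K" "f \<in> set_hom (R k) A" "x = arr G (R k) A f (u k)"
          by (rule universal_family_ex[OF u])
        then show ?thesis
          by (simp add: \<alpha>_eq set_functor_app[OF F] c_elt)
      qed
      then show "\<alpha> A \<in> set_hom (obj G A) (obj F A)"
        by (auto simp: set_hom_def \<alpha>_def)
    next
      fix A B f x
      assume f: "f \<in> set_hom A B" and "x \<in> elts (obj G A)"
      from this(2) obtain k g where k: "k \<in> K" "g \<in> set_hom (R k) A" "x = arr G (R k) A g (u k)"
        by (rule universal_family_ex[OF u])
      \<comment> \<open>For \<open>x = G g u_k\<close>, both sides become
        \<open>F (f o g) c_k\<close>.\<close>
      then show "\<alpha> B (arr G A B f x) = arr F A B f (\<alpha> A x)"
        using f by (simp add: \<alpha>_eq set_functor_compose[OF G] set_functor_compose[OF F]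
            u_elt c_elt set_hom_compose)
    qed
    moreover have "?eval \<alpha> = c"
    proof (rule PiE_ext)
      \<comment> \<open>The defining formula at the identity of \<open>R k\<close>, on which both
        functors act trivially.\<close>
      have "\<alpha> (R k) (u k) = c k" if "k \<in> K" for k
        using \<alpha>_eq[OF that set_hom_id] that
        by (simp add: set_functor_id[OF G] set_functor_id[OF F] u_elt c_elt)
      then show "?eval \<alpha> k = c k" if "k \<in> K" for k
        using that by simp
      then show "?eval \<alpha> \<in> (\<Pi>\<^sub>E k\<in>K. elts (obj F (R k)))"
        using c_elt by auto
    qed (rule c)
    ultimately show "c \<in> ?eval ` nat_trans G F"
      by blast
  qed
  ultimately show ?thesis
    unfolding eqpoll_def bij_betw_def by blast
qed

section \<open>Universal elements of a coproduct of hom functors\<close>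

lemma vgraph_cong: "(\<And>x. x \<in> elts A \<Longrightarrow> f x = g x) \<Longrightarrow> vgraph A f = vgraph A g"
  by (simp add: vgraph_def)

text \<open>In the coproduct itself, the identity of \<open>X i\<close> in the summand
  \<open>i\<close> is universal; the isomorphism carries these elements back to
  \<open>F\<close>.\<close>

lemma universal_family_coproduct_hom:
  fixes F :: "'v::set_universe endo"
  assumes F: "set_functor F"
    and iso: "nat_isomorphic F (coproduct_functor I (\<lambda>i. hom_functor (X i)))"
  obtains u where "universal_family F (elts I) X u"
proof -
  let ?C = "coproduct_functor I (\<lambda>i. hom_functor (X i))"
  obtain \<theta> where \<theta>: "\<theta> \<in> nat_trans F ?C"
    and bij: "\<And>A. bij_betw (\<theta> A) (elts (obj F A)) (elts (obj ?C A))"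
    using iso unfolding nat_isomorphic_def by blast
  have obj_C: "elts (obj ?C A) =
      {vpair i (vgraph (X i) f) |i f. i \<in> elts I \<and> f \<in> set_hom (X i) A}" for A
    by (auto simp: coproduct_functor_def hom_functor_def elts_vSigma elts_vhom)
  let ?id = "\<lambda>i. vpair i (vgraph (X i) (\<lambda>x\<in>elts (X i). x))"
  define u where "u i = inv_into (elts (obj F (X i))) (\<theta> (X i)) (?id i)" for i
  have id: "?id i \<in> elts (obj ?C (X i))" if "i \<in> elts I" for i
    using that set_hom_id unfolding obj_C by blast
  have u_elt: "u i \<in> elts (obj F (X i))" and \<theta>_u: "\<theta> (X i) (u i) = ?id i"
    if "i \<in> elts I" for i
    using id[OF that] bij[of "X i"] unfolding u_def bij_betw_def
    by (auto intro: inv_into_into f_inv_into_f)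
  \<comment> \<open>By naturality the left side is the action of \<open>f\<close> on the identity in
    summand \<open>i\<close>, and that is \<open>f\<close> itself, coded by its graph.\<close>
  have \<theta>_arr: "\<theta> A (arr F (X i) A f (u i)) = vpair i (vgraph (X i) f)"
    if i: "i \<in> elts I" and f: "f \<in> set_hom (X i) A" for i f A
  proof -
    have "vgraph (X i) (\<lambda>x\<in>elts (X i). x) \<in> elts (vhom (X i) (X i))"
      unfolding elts_vhom using set_hom_id by blast
    then have "arr ?C (X i) A f (?id i) = vpair i (vgraph (X i) f)"
      using i by (auto simp: coproduct_functor_def hom_functor_def elts_vSigma intro: vgraph_cong)
    then show ?thesis
      using nat_trans_natural[OF \<theta> f u_elt[OF i]] \<theta>_u[OF i] by simp
  qed
  have "universal_family F (elts I) X u"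
    unfolding universal_family_def
  proof (intro conjI allI ballI)
    fix A
    let ?S = "SIGMA i:elts I. set_hom (X i) A" and ?\<Phi> = "\<lambda>(i, f). arr F (X i) A f (u i)"
    \<comment> \<open>The points of the coproduct at \<open>A\<close> are exactly the tagged graphs,
      and a graph determines its extensional map.\<close>
    have "bij_betw (\<lambda>(i, f). vpair i (vgraph (X i) f)) ?S (elts (obj ?C A))"
      unfolding obj_C by (auto simp: bij_betw_def inj_on_def dest: inj_onD[OF vgraph_inj_on])
    then have "bij_betw (\<theta> A \<circ> ?\<Phi>) ?S (elts (obj ?C A))"
      by (rule bij_betw_cong[THEN iffD1, rotated]) (auto simp: \<theta>_arr)
    moreover have "?\<Phi> ` ?S \<subseteq> elts (obj F A)"
      using set_functor_app[OF F] u_elt by auto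
    \<comment> \<open>Since \<open>\<theta> A\<close> and its composite with \<open>?\<Phi>\<close>
      are both bijective, so is \<open>?\<Phi>\<close>.\<close>
    ultimately show "bij_betw ?\<Phi> ?S (elts (obj F A))"
      using bij_betw_comp_iff2[OF bij] by blast
  qed (rule u_elt)
  then show thesis
    by (rule that)
qed

section \<open>Disjoint unions and products of functors\<close>

definition vinl_map :: "'v::set_universe \<Rightarrow> 'v \<Rightarrow> 'v" where
  "vinl_map A = (\<lambda>x\<in>elts A. vInl x)"

definition vinr_map :: "'v::set_universe \<Rightarrow> 'v \<Rightarrow> 'v" where
  "vinr_map B = (\<lambda>x\<in>elts B. vInr x)"

text \<open>Maps do not record their codomain, so the same injection serves every
  \<open>B\<close>.\<close>

lemma vinl_map_hom: "vinl_map A \<in> set_hom A (vsum A B)"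
  by (auto simp: vinl_map_def set_hom_def elts_vsum)

lemma vinr_map_hom: "vinr_map B \<in> set_hom B (vsum A B)"
  by (auto simp: vinr_map_def set_hom_def elts_vsum)

text \<open>Uniqueness half of the universal property of the coproduct: the two injections cover the
  disjoint union.\<close>

lemma vsum_hom_eqI:
  assumes f: "f \<in> set_hom (vsum A B) C" and g: "g \<in> set_hom (vsum A B) C"
    and l: "compose (elts A) f (vinl_map A) = compose (elts A) g (vinl_map A)"
    and r: "compose (elts B) f (vinr_map B) = compose (elts B) g (vinr_map B)"
  shows "f = g"
proof (rule set_hom_eqI[OF f g])
  fix z
  have "f (vInl x) = g (vInl x)" if "x \<in> elts A" for x
    using fun_cong[OF l, of x] that by (simp add: compose_def vinl_map_def)
  moreover have "f (vInr x) = g (vInr x)" if "x \<in> elts B" for x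
    using fun_cong[OF r, of x] that by (simp add: compose_def vinr_map_def)
  moreover assume "z \<in> elts (vsum A B)"
  ultimately show "f z = g z"
    by (auto simp: elts_vsum)
qed

text \<open>Existence half of the universal property, by case distinction on the tag.\<close>

lemma vsum_copair:
  assumes f: "f \<in> set_hom A C" and g: "g \<in> set_hom B C"
  obtains h where "h \<in> set_hom (vsum A B) C"
    "compose (elts A) h (vinl_map A) = f" "compose (elts B) h (vinr_map B) = g"
proof
  \<comment> \<open>Membership in \<open>range vInl\<close> reads off the tag, and
    \<open>vsnd\<close> strips it.\<close>
  let ?h = "\<lambda>z\<in>elts (vsum A B). if z \<in> range vInl then f (vsnd z) else g (vsnd z)"
  have snd: "vsnd (vInl x) = x" "vsnd (vInr x) = x" for x :: 'a
    by (simp_all add: vInl_def vInr_def)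
  have notin: "vInr x \<notin> range vInl" for x :: 'a
    by (metis rangeE vInl_neq_vInr)
  show h: "?h \<in> set_hom (vsum A B) C"
    using f g by (auto simp: set_hom_def elts_vsum snd notin)
  show "compose (elts A) ?h (vinl_map A) = f"
    by (rule set_hom_eqI[OF set_hom_compose[OF vinl_map_hom h] f])
      (simp add: compose_def vinl_map_def elts_vsum snd)
  show "compose (elts B) ?h (vinr_map B) = g"
    by (rule set_hom_eqI[OF set_hom_compose[OF vinr_map_hom h] g])
      (simp add: compose_def vinr_map_def elts_vsum snd notin)
qed

text \<open>A point of the product at \<open>A\<close> comes from unique maps
  \<open>R k \<rightarrow> A\<close> and \<open>S l \<rightarrow> A\<close>, that is, from one map
  out of their disjoint union. The identity of that union corresponds to the two injections, whence
  the proposed universal pair.\<close>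

lemma universal_family_product:
  fixes F G :: "'v::set_universe endo"
  assumes F: "set_functor F" and G: "set_functor G"
    and u: "universal_family F K R u" and v: "universal_family G L S v"
  shows "universal_family (product_functor F G) (K \<times> L) (\<lambda>(k, l). vsum (R k) (S l))
    (\<lambda>(k, l). vpair (arr F (R k) (vsum (R k) (S l)) (vinl_map (R k)) (u k))
                    (arr G (S l) (vsum (R k) (S l)) (vinr_map (S l)) (v l)))"
    (is "universal_family ?P _ ?T ?w")
proof -
  note u_elt = universal_family_elt[OF u] and v_elt = universal_family_elt[OF v]
  have obj_P: "elts (obj ?P A) = {vpair a b |a b. a \<in> elts (obj F A) \<and> b \<in> elts (obj G A)}" for A
    by (simp add: product_functor_def elts_vtimes)
  have w_elt: "?w (k, l) \<in> elts (obj ?P (?T (k, l)))" if "k \<in> K" "l \<in> L" for k l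
    using that by (auto simp: obj_P u_elt v_elt
        intro!: set_functor_app[OF F vinl_map_hom] set_functor_app[OF G vinr_map_hom])
  \<comment> \<open>Acting by \<open>h\<close> on the universal pair restricts \<open>h\<close>
    along the two injections, which reduces everything below to \<open>u\<close> and
    \<open>v\<close>.\<close>
  have arr_w: "arr ?P (?T (k, l)) A h (?w (k, l)) =
      vpair (arr F (R k) A (compose (elts (R k)) h (vinl_map (R k))) (u k))
            (arr G (S l) A (compose (elts (S l)) h (vinr_map (S l))) (v l))"
    if "k \<in> K" "l \<in> L" "h \<in> set_hom (vsum (R k) (S l)) A" for k l h A
    using w_elt[OF that(1,2)] that
    by (simp add: product_functor_def u_elt v_elt
        set_functor_compose[OF F vinl_map_hom] set_functor_compose[OF G vinr_map_hom])
  show ?thesis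
    unfolding universal_family_def
  proof (intro conjI allI ballI)
    fix p
    assume "p \<in> K \<times> L"
    then show "?w p \<in> elts (obj ?P (?T p))"
      using w_elt by auto
  next
    fix A
    let ?D = "SIGMA p:K \<times> L. set_hom (?T p) A" and ?\<Phi> = "\<lambda>(p, h). arr ?P (?T p) A h (?w p)"
    have "inj_on ?\<Phi> ?D"
    proof (rule inj_onI)
      fix y y'
      assume "y \<in> ?D" "y' \<in> ?D" and eq: "?\<Phi> y = ?\<Phi> y'"
      then obtain k l h k' l' h' where y: "y = ((k, l), h)" "y' = ((k', l'), h')"
        and kl: "k \<in> K" "l \<in> L" "k' \<in> K" "l' \<in> L"
        and h: "h \<in> set_hom (vsum (R k) (S l)) A" and h': "h' \<in> set_hom (vsum (R k') (S l')) A"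
        by auto
      have "arr ?P (?T (k, l)) A h (?w (k, l)) = arr ?P (?T (k', l')) A h' (?w (k', l'))"
        using eq unfolding y by simp
      note eq' = this[unfolded arr_w[OF kl(1,2) h] arr_w[OF kl(3,4) h'] vpair_eq_iff]
      \<comment> \<open>Equality of the first components, with universality of \<open>u\<close>,
        recovers the first index and the restriction of \<open>h\<close> to the first summand; the
        second components do the same for \<open>v\<close>.\<close>
      have l: "k = k' \<and> compose (elts (R k)) h (vinl_map (R k)) =
          compose (elts (R k')) h' (vinl_map (R k'))"
        using eq' by (intro universal_family_unique[OF u kl(1,3)])
          (auto intro: set_hom_compose[OF vinl_map_hom] h h')
      have r: "l = l' \<and> compose (elts (S l)) h (vinr_map (S l)) =
          compose (elts (S l')) h' (vinr_map (S l'))"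
        using eq' by (intro universal_family_unique[OF v kl(2,4)])
          (auto intro: set_hom_compose[OF vinr_map_hom] h h')
      \<comment> \<open>Once the indices agree, \<open>h\<close> and \<open>h'\<close> have the same
        domain and agree along both injections.\<close>
      show "y = y'"
        using vsum_hom_eqI[OF h] h' l r by (auto simp: y)
    qed
    moreover have "?\<Phi> ` ?D = elts (obj ?P A)"
    proof (intro equalityI subsetI)
      fix x
      assume "x \<in> ?\<Phi> ` ?D"
      then obtain k l h where "k \<in> K" "l \<in> L" "h \<in> set_hom (?T (k, l)) A"
        and x: "x = arr ?P (?T (k, l)) A h (?w (k, l))"
        by auto
      then show "x \<in> elts (obj ?P A)"
        unfolding x by (intro set_functor_app[OF set_functor_product[OF F G]] w_elt)
    next
      fix x
      assume "x \<in> elts (obj ?P A)"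
      then obtain a b where x: "x = vpair a b" "a \<in> elts (obj F A)" "b \<in> elts (obj G A)"
        by (auto simp: obj_P)
      obtain k f where k: "k \<in> K" "f \<in> set_hom (R k) A" "a = arr F (R k) A f (u k)"
        by (rule universal_family_ex[OF u x(2)])
      obtain l g where l: "l \<in> L" "g \<in> set_hom (S l) A" "b = arr G (S l) A g (v l)"
        by (rule universal_family_ex[OF v x(3)])
      \<comment> \<open>The copairing of \<open>f\<close> and \<open>g\<close> is the required
        preimage, over the index \<open>(k, l)\<close>.\<close>
      obtain h where h: "h \<in> set_hom (vsum (R k) (S l)) A"
        "compose (elts (R k)) h (vinl_map (R k)) = f" "compose (elts (S l)) h (vinr_map (S l)) = g"
        by (rule vsum_copair[OF k(2) l(2)])
      have "x = ?\<Phi> ((k, l), h)"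
        using arr_w[OF k(1) l(1) h(1)] h(2,3) k(3) l(3) x(1) by simp
      moreover have "((k, l), h) \<in> ?D"
        using k(1) l(1) h(1) by simp
      ultimately show "x \<in> ?\<Phi> ` ?D"
        by (rule image_eqI)
    qed
    ultimately show "bij_betw ?\<Phi> ?D (elts (obj ?P A))"
      by (simp only: bij_betw_def)
  qed
qed

theorem theorem4p3:
  fixes F :: "'v::set_universe endo" and I :: 'v and X :: "'v \<Rightarrow> 'v"
  assumes "set_functor F"
    and "elts I \<noteq> {}"
    and "nat_isomorphic F (coproduct_functor I (\<lambda>i. hom_functor (X i)))"
  shows "nat_trans (product_functor F F) F \<approx>
         (\<Pi>\<^sub>E (i, j)\<in>elts I \<times> elts I. elts (obj F (vsum (X i) (X j))))"
proof -
  obtain u where u: "universal_family F (elts I) X u"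
    by (rule universal_family_coproduct_hom[OF assms(1,3)])
  \<comment> \<open>The Yoneda bijection for \<open>F \<times> F\<close>, whose universal elements
    live over the sets \<open>X i + X j\<close>.\<close>
  have "nat_trans (product_functor F F) F \<approx>
      (\<Pi>\<^sub>E p\<in>elts I \<times> elts I. elts (obj F (case p of (i, j) \<Rightarrow> vsum (X i) (X j))))"
    by (rule nat_trans_universal_family_eqpoll[OF assms(1) set_functor_product[OF assms(1,1)]
          universal_family_product[OF assms(1,1) u u]])
  moreover have "(\<lambda>p. elts (obj F (case p of (i, j) \<Rightarrow> vsum (X i) (X j)))) =
      (\<lambda>(i, j). elts (obj F (vsum (X i) (X j))))"
    by auto
  ultimately show ?thesis
    by simp
qed

end
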